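(* Let $S$ be a finite set and $f:S\to S$ a function. Fix an isomorphism type $T$ of pseudocycles, with cycle length $|T|$, and let $\mathbf{P}_T=\{P_{T,1},\dots,P_{T,n_T}\}$ be the set of $f$-pseudocycles of type $T$. For every $j$ choose an element $x_{T,j}\in\mathcal{V}(\mathcal{Z}(P_{T,j}))$ and put $X_T=\{x_{T,1},\dots,x_{T,n_T}\}$. Then for every permutation $g$ of $S$ with $fg=gf$, the restriction of $g$ to $\mathcal{V}(\mathbf{P}_T)=\bigsqcup_j\mathcal{V}(P_{T,j})$ is bijectively determined by the triple $[\widetilde g_T,g|_{X_T},A_T]$, where $\widetilde g_T$ is the permutation of $\mathbf{P}_T$ induced by $g$, and $A_T=[\alpha_{jk}]$ with $\alpha_{jk}$ the restriction of $g$ to $\mathcal{T}(f^k(x_{T,j}))$, $1\le j\le n_T$, $0\le k\le |T|-1$. That is, assigning this triple to the restriction is a bijection from the set of restrictions to $\mathcal{V}(\mathbf{P}_T)$ of permutations of $S$ commuting with $f$ onto the set of triples $[\pi,h,A]$ such that: (1) $\pi$ is a permutation of $\mathbf{P}_T$; (2) $h:X_T\to S$ is a function with $h(x_{T,j})\in\mathcal{V}(\mathcal{Z}(\pi(P_{T,j})))$ and $\mathcal{T}(f^k(x_{T,j}))\simeq\mathcal{T}(f^k(h(x_{T,j})))$ for all $j\in\{1,\dots,n_T\}$ and $k\in\{0,\dots,|T|-1\}$; (3) $A=[\alpha_{jk}]$ with $\alpha_{jk}:\mathcal{T}(f^k(x_{T,j}))\to\mathcal{T}(f^k(h(x_{T,j})))$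 an isomorphism of rooted directed trees for all $j\in\{1,\dots,n_T\}$ and $k\in\{0,\dots,|T|-1\}$.
   Context: The functional graph $\Gamma(f)$ has vertex set $S$ and edges $[s,f(s)]$, $s\in S$. For finite $S$ each weakly connected component $P$ of $\Gamma(f)$ is called an $f$-pseudocycle: it contains exactly one directed cycle (possibly a loop), denoted $\mathcal{Z}(P)$, and every other vertex has a unique directed path to the closest cycle vertex. $\mathcal{V}(\cdot)$ denotes the vertex set. For a vertex $z$ of $\mathcal{Z}(P)$, $\mathcal{T}(z)$ is the directed tree with root $z$ consisting of $z$ and all vertices whose forward path meets $\mathcal{Z}(P)$ first at $z$ (edges directed toward the root). A pseudocycle is described by its cyclic sequence of rooted directed trees (its tree cycle); two pseudocycles are isomorphic iff their tree cycles agree up to tree isomorphism and a cyclic shift. The cycle length of a pseudocycle is the length of its directed cycle. A permutation commuting with $f$ maps each $f$-pseudocycle isomorphically onto an $f$-pseudocycle. *)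

theory Defs
  imports
    "Graph_Theory.Digraph_Isomorphism"
    "HOL-Library.FuncSet"
    "HOL-Combinatorics.Permutations"
begin

definition functional_graph :: "'a set \<Rightarrow> ('a \<Rightarrow> 'a) \<Rightarrow> ('a, 'a \<times> 'a) pre_digraph" where
  "functional_graph S f =
     \<lparr> verts = S, arcs = {(s, f s) | s. s \<in> S}, tail = fst, head = snd \<rparr>"

(* The analogue of pre_digraph.sccs for weak connectivity
   (connected G means that the underlying symmetric graph is strongly connected). *)
definition wccs :: "('a, 'b) pre_digraph \<Rightarrow> ('a, 'b) pre_digraph set" where
  "wccs G = {H. induced_subgraph H G \<and> connected H \<and>
     \<not> (\<exists>H'. induced_subgraph H' G \<and> connected H' \<and> verts H \<subset> verts H')}"

definition pseudocycles :: "'a set \<Rightarrow> ('a \<Rightarrow> 'a) \<Rightarrow> ('a, 'a \<times> 'a) pre_digraph set" where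
  "pseudocycles S f = wccs (functional_graph S f)"

definition is_pseudocycle :: "('a, 'a \<times> 'a) pre_digraph \<Rightarrow> bool" where
  "is_pseudocycle P \<longleftrightarrow> (\<exists>S f. finite S \<and> f \<in> S \<rightarrow> S \<and> P \<in> pseudocycles S f)"

(* An isomorphism type is given by a representative T, which may live on another ground type;
   in this way types that do not occur in the functional graph of f are covered too. *)
definition pseudocycles_of_type ::
    "'a set \<Rightarrow> ('a \<Rightarrow> 'a) \<Rightarrow> ('b, 'b \<times> 'b) pre_digraph \<Rightarrow> ('a, 'a \<times> 'a) pre_digraph set" where
  "pseudocycles_of_type S f T = {P \<in> pseudocycles S f. digraph_iso P T}"

(* The union of all directed cycles (loops included) of P. A pseudocycle contains exactly one
   directed cycle, up to the choice of the starting vertex of the closed walk, so there this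
   is the directed cycle Z(P). *)
definition cycle_graph :: "('a, 'b) pre_digraph \<Rightarrow> ('a, 'b) pre_digraph" where
  "cycle_graph P = P \<lparr> verts := (\<Union>p \<in> {p. pre_digraph.cycle P p}. tail P ` set p),
                       arcs := (\<Union>p \<in> {p. pre_digraph.cycle P p}. set p) \<rparr>"

definition cycle_length :: "('a, 'b) pre_digraph \<Rightarrow> nat" where
  "cycle_length P = card (arcs (cycle_graph P))"

(* Vertices from which a walk leads to z without meeting Z(P) before z; z itself belongs to
   it by the empty walk. *)
definition tree_verts :: "('a, 'b) pre_digraph \<Rightarrow> 'a \<Rightarrow> 'a set" where
  "tree_verts P z = {s. \<exists>p. pre_digraph.awalk P s p z \<and>
     set (pre_digraph.awalk_verts P s p) \<inter> verts (cycle_graph P) = {z}}"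

(* The arc leaving the root belongs to Z(P) and not to the tree. It has to be excluded
   explicitly because it may be a loop. *)
definition rooted_tree :: "('a, 'b) pre_digraph \<Rightarrow> 'a \<Rightarrow> ('a, 'b) pre_digraph" where
  "rooted_tree P z = P \<lparr> verts := tree_verts P z,
     arcs := {e \<in> arcs P. tail P e \<in> tree_verts P z - {z} \<and> head P e \<in> tree_verts P z} \<rparr>"

(* For digraphs whose arcs are pairs: the digraph morphism induced by a vertex map. *)
definition pair_hom :: "('a \<Rightarrow> 'b) \<Rightarrow> ('a, 'a \<times> 'a, 'b, 'b \<times> 'b) digraph_isomorphism" where
  "pair_hom g = \<lparr> iso_verts = g, iso_arcs = map_prod g g, iso_head = snd, iso_tail = fst \<rparr>"

(* Root-preserving isomorphisms from D (root r) to D' (root r'), as functions on the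
   vertices of D, i.e. with value undefined elsewhere. *)
definition rooted_isos ::
    "('a, 'a \<times> 'a) pre_digraph \<Rightarrow> 'a \<Rightarrow> ('b, 'b \<times> 'b) pre_digraph \<Rightarrow> 'b \<Rightarrow> ('a \<Rightarrow> 'b) set" where
  "rooted_isos D r D' r' = {\<alpha> \<in> extensional (verts D).
     pre_digraph.digraph_isomorphism D (pair_hom \<alpha>) \<and> app_iso (pair_hom \<alpha>) D = D' \<and> \<alpha> r = r'}"

definition tree_isos ::
    "('a, 'a \<times> 'a) pre_digraph \<Rightarrow> 'a \<Rightarrow> ('b, 'b \<times> 'b) pre_digraph \<Rightarrow> 'b \<Rightarrow> ('a \<Rightarrow> 'b) set" where
  "tree_isos P z Q w = rooted_isos (rooted_tree P z) z (rooted_tree Q w) w"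

definition trees_isomorphic ::
    "('a, 'a \<times> 'a) pre_digraph \<Rightarrow> 'a \<Rightarrow> ('b, 'b \<times> 'b) pre_digraph \<Rightarrow> 'b \<Rightarrow> bool" where
  "trees_isomorphic P z Q w \<longleftrightarrow> tree_isos P z Q w \<noteq> {}"

definition commuting_perms :: "'a set \<Rightarrow> ('a \<Rightarrow> 'a) \<Rightarrow> ('a \<Rightarrow> 'a) set" where
  "commuting_perms S f = {g. g permutes S \<and> (\<forall>s\<in>S. f (g s) = g (f s))}"

(* The map P |-> g(P) on a set of digraphs, continued by the identity as usual for permutes. *)
definition induced_perm ::
    "('a, 'a \<times> 'a) pre_digraph set \<Rightarrow> ('a \<Rightarrow> 'a) \<Rightarrow>
     ('a, 'a \<times> 'a) pre_digraph \<Rightarrow> ('a, 'a \<times> 'a) pre_digraph" where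
  "induced_perm \<P> g = (\<lambda>P. if P \<in> \<P> then app_iso (pair_hom g) P else P)"

end

theory Submission
  imports Defs "HOL-Combinatorics.Orbits"
begin

text \<open>
  A vertex \<open>z\<close> lies on a directed cycle of the functional graph of \<open>f\<close> exactly when
  \<open>z \<in> orbit f z\<close>, and every vertex of the finite set \<open>S\<close> reaches such a periodic point under
  iteration. Hence \<open>S\<close> is partitioned into branches: the branch of a periodic \<open>z\<close> consists of the
  vertices whose forward path meets the cycles first at \<open>z\<close>, and it is the vertex set of the tree
  rooted at \<open>z\<close>. A pseudocycle is the functional graph of a set \<open>C\<close> closed under images and
  preimages in which any two forward paths meet (\<open>pseudocycles_conv\<close>). Two forward paths that meet
  end in the same cycle, so the periodic points of \<open>C\<close> form a single orbit, whose length is the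
  cycle length and is an isomorphism invariant (\<open>cycle_length_iso\<close>).

  Write \<open>L\<close> for the cycle length of the type \<open>T\<close>. Since \<open>x\<^sub>j\<close> lies on the cycle of \<open>P\<^sub>j\<close>, the
  points \<open>f\<^sup>k x\<^sub>j\<close> with \<open>k < L\<close> run once through all periodic points of the vertex set \<open>V\<close> of the
  pseudocycles of type \<open>T\<close>, and their branches partition \<open>V\<close>. The restriction of \<open>g\<close> to \<open>V\<close> is
  therefore recovered from its restrictions \<open>\<alpha>\<^sub>j\<^sub>k\<close> to these branches, which gives injectivity.

  For surjectivity, the isomorphisms \<open>\<alpha>\<^sub>j\<^sub>k\<close> of a triple \<open>(\<pi>, h, A)\<close> are glued along the partition
  (\<open>admissible_data_realized\<close>). The points \<open>h x\<^sub>j\<close> lie on the cycles of the pseudocycles \<open>\<pi> P\<^sub>j\<close>,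
  which are again all pseudocycles of type \<open>T\<close>; so the points \<open>f\<^sup>k (h x\<^sub>j)\<close> enumerate the periodic
  points of \<open>V\<close> as well, and the glued map is a bijection of \<open>V\<close>. It commutes with \<open>f\<close> away from the
  roots because each \<open>\<alpha>\<^sub>j\<^sub>k\<close> preserves arcs. At the roots it sends \<open>f\<^sup>k x\<^sub>j\<close> to \<open>f\<^sup>k (h x\<^sub>j)\<close>, which is
  compatible with \<open>f\<close> because both cycles close after the same number \<open>L\<close> of steps. Extended by
  the identity, the glued map is a permutation of \<open>S\<close> commuting with \<open>f\<close>.
\<close>

section \<open>Pseudocycles as closed sets of meeting paths\<close>

lemma functional_graph_simps [simp]:
  "verts (functional_graph C f) = C"
  "arcs (functional_graph C f) = (\<lambda>s. (s, f s)) ` C"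
  "tail (functional_graph C f) = fst"
  "head (functional_graph C f) = snd"
  by (auto simp: functional_graph_def)

lemma wf_functional_graph: "f \<in> C \<rightarrow> C \<Longrightarrow> wf_digraph (functional_graph C f)"
  by unfold_locales auto

lemma arcs_ends_functional_graph: "arcs_ends (functional_graph C f) = (\<lambda>s. (s, f s)) ` C"
  by (simp add: arcs_ends_conv image_image)

lemma app_iso_functional_graph:
  assumes "\<And>s. s \<in> C \<Longrightarrow> f' (g s) = g (f s)"
  shows "app_iso (pair_hom g) (functional_graph C f) = functional_graph (g ` C) f'"
  using assms by (intro pre_digraph.equality) (auto simp: pair_hom_def image_image)

lemma digraph_isomorphism_pair_hom:
  assumes "wf_digraph G" "tail G = fst" "head G = snd" "inj_on g (verts G)"
  shows "pre_digraph.digraph_isomorphism G (pair_hom g)"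
proof -
  have "arcs G \<subseteq> verts G \<times> verts G"
    using wf_digraph.tail_in_verts[OF assms(1)] wf_digraph.head_in_verts[OF assms(1)] assms(2,3)
    by auto
  then have "inj_on (map_prod g g) (arcs G)"
    using map_prod_inj_on[OF assms(4,4)] by (rule inj_on_subset[rotated])
  then show ?thesis
    using assms by (simp add: pre_digraph.digraph_isomorphism_def pair_hom_def)
qed

text \<open>
  Weak connectedness is expressed by forward paths only: in a functional graph two vertices are
  joined by an undirected walk exactly when their forward paths meet.
\<close>
definition weak_component :: "'a set \<Rightarrow> ('a \<Rightarrow> 'a) \<Rightarrow> 'a set \<Rightarrow> bool" where
  "weak_component S f C \<longleftrightarrow> C \<noteq> {} \<and> C \<subseteq> S \<and> f \<in> C \<rightarrow> C \<and> (\<forall>s\<in>S. f s \<in> C \<longrightarrow> s \<in> C) \<and>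
     (\<forall>u\<in>C. \<forall>v\<in>C. \<exists>m n. (f ^^ m) u = (f ^^ n) v)"

lemma weak_component_subset: "weak_component S f C \<Longrightarrow> C \<subseteq> S"
  and weak_component_into: "weak_component S f C \<Longrightarrow> f \<in> C \<rightarrow> C"
  and weak_component_meet:
    "weak_component S f C \<Longrightarrow> u \<in> C \<Longrightarrow> v \<in> C \<Longrightarrow> \<exists>m n. (f ^^ m) u = (f ^^ n) v"
  unfolding weak_component_def by blast+

lemma funpow_mem: "f \<in> C \<rightarrow> C \<Longrightarrow> s \<in> C \<Longrightarrow> (f ^^ n) s \<in> C"
  by (induction n) auto

text \<open>
  Iterates the closure under single preimages. The intermediate iterates stay in \<open>S\<close>, where that
  closure applies.
\<close>
lemma weak_component_preimage:
  assumes "weak_component S f C" "f \<in> S \<rightarrow> S" "v \<in> S" "(f ^^ n) v \<in> C"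
  shows "v \<in> C"
  using assms(3,4)
proof (induction n arbitrary: v)
  case (Suc n)
  then have "f v \<in> C" using assms(2) by (auto simp: funpow_swap1)
  then show ?case using assms(1) Suc.prems by (auto simp: weak_component_def)
qed simp

text \<open>
  Meeting of forward paths survives one more arc in either direction, because every vertex has only
  one outgoing arc. The set \<open>F\<close> that contains the walk is arbitrary, so that the lemma also serves
  for walks inside a subgraph.
\<close>
lemma weakly_reachable_imp_meet:
  assumes "(u, v) \<in> rtrancl_on F ((arcs_ends (functional_graph C f))\<^sup>s)"
  shows "\<exists>m n. (f ^^ m) u = (f ^^ n) v"
  using assms
proof (induction rule: rtrancl_on_induct)
  case base
  show ?case by blast
next
  case (step y z)
  then obtain m n where mn: "(f ^^ m) u = (f ^^ n) y" by blast
  from step.hyps have "z = f y \<or> y = f z"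
    by (auto simp: symcl_def arcs_ends_functional_graph)
  then show ?case
  proof
    assume "z = f y"
    then have "(f ^^ Suc m) u = (f ^^ n) z" using mn by (simp add: funpow_swap1)
    then show ?thesis by blast
  next
    assume "y = f z"
    then have "(f ^^ m) u = (f ^^ Suc n) z" using mn by (simp add: funpow_swap1)
    then show ?thesis by blast
  qed
qed

lemma connected_functional_graph_iff:
  assumes "f \<in> C \<rightarrow> C"
  shows "connected (functional_graph C f) \<longleftrightarrow>
    C \<noteq> {} \<and> (\<forall>u\<in>C. \<forall>v\<in>C. \<exists>m n. (f ^^ m) u = (f ^^ n) v)"
proof
  assume "connected (functional_graph C f)"
  then show "C \<noteq> {} \<and> (\<forall>u\<in>C. \<forall>v\<in>C. \<exists>m n. (f ^^ m) u = (f ^^ n) v)"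
    unfolding connected_conv using weakly_reachable_imp_meet[of _ _ C C f] by simp
next
  assume meet: "C \<noteq> {} \<and> (\<forall>u\<in>C. \<forall>v\<in>C. \<exists>m n. (f ^^ m) u = (f ^^ n) v)"
  let ?R = "rtrancl_on C ((arcs_ends (functional_graph C f))\<^sup>s)"
  have forward: "(u, (f ^^ n) u) \<in> ?R \<and> ((f ^^ n) u, u) \<in> ?R" if "u \<in> C" for u n
  proof (induction n)
    case (Suc n)
    have mem: "(f ^^ n) u \<in> C" "f ((f ^^ n) u) \<in> C"
      using that assms by (auto intro: funpow_mem[OF assms] funcset_mem[OF assms])
    then have "((f ^^ n) u, f ((f ^^ n) u)) \<in> (arcs_ends (functional_graph C f))\<^sup>s"
      "(f ((f ^^ n) u), (f ^^ n) u) \<in> (arcs_ends (functional_graph C f))\<^sup>s"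
      by (force simp: symcl_def arcs_ends_functional_graph)+
    with mem Suc show ?case
      by (auto intro: rtrancl_on_into_rtrancl_on converse_rtrancl_on_into_rtrancl_on)
  qed (use that in auto)
  have "(u, v) \<in> ?R" if uv: "u \<in> C" "v \<in> C" for u v
  proof -
    obtain m n where "(f ^^ m) u = (f ^^ n) v" using meet uv by blast
    then show ?thesis using forward[OF uv(1), of m] forward[OF uv(2), of n]
      by (metis rtrancl_on_trans)
  qed
  then show "connected (functional_graph C f)"
    using meet by (simp add: connected_conv)
qed

text \<open>
  This forces a maximal connected induced subgraph to be closed under images and preimages: otherwise
  it could be enlarged by the missing neighbour.
\<close>
lemma insert_adjacent_connected:
  assumes H: "induced_subgraph H G" "connected H" and wf: "wf_digraph G"
    and u: "u \<in> verts H" and v: "v \<in> verts G"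
    and uv: "(u, v) \<in> (arcs_ends G)\<^sup>s"
  shows "\<exists>H'. induced_subgraph H' G \<and> connected H' \<and> verts H' = insert v (verts H)"
proof -
  let ?V = "insert v (verts H)"
  let ?H = "G \<restriction> ?V"
  have sub: "?V \<subseteq> verts G" using H(1) v by auto
  have ind: "induced_subgraph ?H G"
    using sub by (intro wf_digraph.induced_induce[OF wf]) auto
  have comp: "tail H = tail G" "head H = head G"
    using H(1) by (auto simp: induced_subgraph_def subgraph_def compatible_def)
  have ends: "arcs_ends H \<subseteq> arcs_ends ?H"
    using H(1) by (auto simp: arcs_ends_conv comp induced_subgraph_def)
  have old: "(a, b) \<in> rtrancl_on ?V ((arcs_ends ?H)\<^sup>s)" if "a \<in> verts H" "b \<in> verts H" for a b
  proof -
    have "(a, b) \<in> rtrancl_on (verts H) ((arcs_ends H)\<^sup>s)"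
      using H(2) that by (auto simp: connected_conv)
    moreover have "(arcs_ends H)\<^sup>s \<subseteq> (arcs_ends ?H)\<^sup>s" using ends by (auto simp: symcl_def)
    ultimately show ?thesis
      by (induction rule: rtrancl_on_induct) (auto intro: rtrancl_on_into_rtrancl_on)
  qed
  have "(u, v) \<in> (arcs_ends ?H)\<^sup>s \<and> (v, u) \<in> (arcs_ends ?H)\<^sup>s"
    using uv u by (force simp: symcl_def arcs_ends_conv)
  then have edge: "(u, v) \<in> rtrancl_on ?V ((arcs_ends ?H)\<^sup>s)" "(v, u) \<in> rtrancl_on ?V ((arcs_ends ?H)\<^sup>s)"
    using u by (auto intro: rtrancl_on_into_rtrancl_on)
  have "connected ?H"
    unfolding connected_conv
  proof (intro conjI ballI)
    fix a b assume "a \<in> verts ?H" "b \<in> verts ?H"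
    then have "(a, u) \<in> rtrancl_on ?V ((arcs_ends ?H)\<^sup>s)" "(u, b) \<in> rtrancl_on ?V ((arcs_ends ?H)\<^sup>s)"
      using old u edge by auto
    then show "(a, b) \<in> rtrancl_on (verts ?H) ((arcs_ends ?H)\<^sup>s)"
      by (simp add: rtrancl_on_trans[of a u])
  qed simp
  with ind show ?thesis by (intro exI[of _ ?H]) simp
qed

text \<open>
  A weakly connected component contains with a vertex all of its neighbours, so its arcs are exactly
  the arcs leaving its vertices. Conversely, any connected subgraph that meets a closed set \<open>C\<close> of
  meeting paths stays inside: the forward path of each of its vertices runs into \<open>C\<close>, and preimages
  lead back into \<open>C\<close>.
\<close>
theorem pseudocycles_conv:
  assumes f: "f \<in> S \<rightarrow> S"
  shows "pseudocycles S f = {functional_graph C f | C. weak_component S f C}"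
proof (intro set_eqI iffI)
  let ?G = "functional_graph S f"
  fix P assume "P \<in> pseudocycles S f"
  then have ind: "induced_subgraph P ?G" and con: "connected P"
    and max: "\<And>H'. induced_subgraph H' ?G \<Longrightarrow> connected H' \<Longrightarrow> \<not> verts P \<subset> verts H'"
    by (auto simp: pseudocycles_def wccs_def)
  let ?C = "verts P"
  have sub: "?C \<subseteq> S" and arcsP: "arcs P = {e \<in> (\<lambda>s. (s, f s)) ` S. fst e \<in> ?C \<and> snd e \<in> ?C}"
    and ends: "tail P = fst" "head P = snd"
    using ind by (auto simp: induced_subgraph_def subgraph_def compatible_def)
  have closed: "v \<in> ?C" if uv: "u \<in> ?C" "v \<in> S" "v = f u \<or> u = f v" for u v
  proof (rule ccontr)
    assume "v \<notin> ?C"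
    have "(u, v) \<in> (arcs_ends ?G)\<^sup>s"
      using uv sub by (force simp: symcl_def arcs_ends_functional_graph)
    then obtain H' where "induced_subgraph H' ?G" "connected H'" "verts H' = insert v ?C"
      using insert_adjacent_connected[OF ind con wf_functional_graph[OF f] uv(1)] uv(2) by auto
    then show False using max \<open>v \<notin> ?C\<close> by blast
  qed
  have step: "f \<in> ?C \<rightarrow> ?C"
    using closed sub f by blast
  have "arcs P = (\<lambda>s. (s, f s)) ` ?C" using arcsP sub step by auto
  then have P: "P = functional_graph ?C f"
    using ends by (intro pre_digraph.equality) auto
  then have "connected (functional_graph ?C f)" using con by simp
  then have "weak_component S f ?C"
    unfolding weak_component_def connected_functional_graph_iff[OF step]
    using sub step closed by blast
  with P show "P \<in> {functional_graph C f | C. weak_component S f C}" by blast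
next
  let ?G = "functional_graph S f"
  fix P assume "P \<in> {functional_graph C f | C. weak_component S f C}"
  then obtain C where P: "P = functional_graph C f" and C: "weak_component S f C" by blast
  from C have step: "f \<in> C \<rightarrow> C" by (simp add: weak_component_def)
  have "subgraph P ?G"
    using C f unfolding P
    by (intro subgraphI) (auto simp: weak_component_def compatible_def intro!: wf_functional_graph)
  moreover have "arcs P = {e \<in> arcs ?G. tail ?G e \<in> verts P \<and> head ?G e \<in> verts P}"
    using C by (auto simp: P weak_component_def)
  ultimately have ind: "induced_subgraph P ?G" ..
  have con: "connected P"
    using C by (simp add: P connected_functional_graph_iff[OF step] weak_component_def)
  have "\<not> verts P \<subset> verts H" if H: "induced_subgraph H ?G" "connected H" for H
  proof
    assume "verts P \<subset> verts H"
    then obtain u v where u: "u \<in> C" "u \<in> verts H" and v: "v \<in> verts H" "v \<notin> C"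
      using C by (auto simp: P weak_component_def)
    have "arcs_ends H \<subseteq> arcs_ends ?G" using H(1) by (auto dest: arcs_ends_mono)
    then have "(arcs_ends H)\<^sup>s \<subseteq> (arcs_ends ?G)\<^sup>s" by (auto simp: symcl_def)
    moreover have "(u, v) \<in> rtrancl_on (verts H) ((arcs_ends H)\<^sup>s)"
      using H(2) u v by (auto simp: connected_conv)
    ultimately have "(u, v) \<in> rtrancl_on (verts H) ((arcs_ends ?G)\<^sup>s)"
      by (metis rtrancl_on_mono order_refl)
    then obtain m n where mn: "(f ^^ m) u = (f ^^ n) v"
      using weakly_reachable_imp_meet by metis
    have "v \<in> S" using subgraph_imp_subverts[OF induced_imp_subgraph[OF H(1)]] v by auto
    moreover have "(f ^^ n) v \<in> C" using mn funpow_mem[OF step u(1), of m] by simp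
    ultimately show False using weak_component_preimage[OF C f] v by blast
  qed
  with ind con show "P \<in> pseudocycles S f"
    by (auto simp: pseudocycles_def wccs_def)
qed

section \<open>Directed cycles of a functional graph\<close>

lemma orbit_funpow:
  assumes "z \<in> orbit f z"
  shows "orbit f ((f ^^ n) z) = orbit f z" "(f ^^ n) z \<in> orbit f ((f ^^ n) z)"
proof -
  have periodic: "(f ^^ n) z \<in> orbit f ((f ^^ n) z)" for n
    using self_in_orbit_trans[OF assms funpow_in_orbit[OF assms]] .
  then show "(f ^^ n) z \<in> orbit f ((f ^^ n) z)" .
  show "orbit f ((f ^^ n) z) = orbit f z"
    using self_in_orbit_step[OF periodic] by (induction n) simp_all
qed

text \<open>
  The least period of a periodic point is the size of its orbit.
\<close>
lemma orbit_enumeration: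
  assumes "z \<in> orbit f z"
  shows "bij_betw (\<lambda>k. (f ^^ k) z) {0..<card (orbit f z)} (orbit f z)"
    and "(f ^^ card (orbit f z)) z = z" and "0 < card (orbit f z)"
proof -
  have "card (orbit f z) = funpow_dist1 f z z"
    using card_image[OF inj_on_funpow_dist1[OF assms]] orbit_conv_funpow_dist1[OF assms] by simp
  then show "bij_betw (\<lambda>k. (f ^^ k) z) {0..<card (orbit f z)} (orbit f z)"
    "(f ^^ card (orbit f z)) z = z" "0 < card (orbit f z)"
    using inj_on_funpow_dist1[OF assms] orbit_conv_funpow_dist1[OF assms]
      funpow_dist1_prop[OF assms] by (simp_all add: bij_betw_def)
qed

text \<open>
  Every vertex has exactly one outgoing arc, so these are the only walks of a functional graph.
\<close>
definition forward_walk :: "('a \<Rightarrow> 'a) \<Rightarrow> 'a \<Rightarrow> nat \<Rightarrow> ('a \<times> 'a) list" where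
  "forward_walk f u n = map (\<lambda>i. ((f ^^ i) u, (f ^^ Suc i) u)) [0..<n]"

lemma forward_walk_Suc: "forward_walk f u (Suc n) = (u, f u) # forward_walk f (f u) n"
  unfolding forward_walk_def
  by (subst upt_conv_Cons) (auto simp: map_Suc_upt[symmetric] funpow_swap1 simp del: upt_Suc)

lemma length_forward_walk [simp]: "length (forward_walk f u n) = n"
  by (simp add: forward_walk_def)

lemma awalk_functional_graph_iff:
  assumes "f \<in> C \<rightarrow> C"
  shows "pre_digraph.awalk (functional_graph C f) u p v \<longleftrightarrow>
    u \<in> C \<and> p = forward_walk f u (length p) \<and> v = (f ^^ length p) u"
proof (induction p arbitrary: u)
  case Nil
  show ?case by (auto simp: pre_digraph.awalk_def pre_digraph.cas.simps forward_walk_def)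
next
  case (Cons e es)
  have "pre_digraph.awalk (functional_graph C f) u (e # es) v \<longleftrightarrow>
      u \<in> C \<and> e = (u, f u) \<and> pre_digraph.awalk (functional_graph C f) (f u) es v"
    using wf_digraph.awalk_Cons_iff[OF wf_functional_graph[OF assms]] by auto
  then show ?case
    using assms by (auto simp: Cons.IH forward_walk_Suc funpow_swap1)
qed

lemma awalk_verts_forward_walk:
  "pre_digraph.awalk_verts (functional_graph C f) u (forward_walk f u n) =
    map (\<lambda>i. (f ^^ i) u) [0..<Suc n]"
proof (induction n arbitrary: u)
  case 0
  show ?case by (simp add: forward_walk_def pre_digraph.awalk_verts.simps)
next
  case (Suc n)
  have "map (\<lambda>i. (f ^^ i) u) [0..<Suc (Suc n)] = u # map (\<lambda>i. (f ^^ i) (f u)) [0..<Suc n]"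
    by (subst upt_conv_Cons) (auto simp: map_Suc_upt[symmetric] funpow_swap1 simp del: upt_Suc)
  then show ?case
    by (simp add: forward_walk_Suc pre_digraph.awalk_verts.simps Suc.IH del: upt_Suc)
qed

text \<open>
  All vertices of a closed walk are periodic. Conversely, following \<open>f\<close> from a periodic \<open>z\<close> for
  \<open>card (orbit f z)\<close> steps closes up without repeating a vertex.
\<close>
lemma cycle_graph_functional_graph:
  assumes "f \<in> C \<rightarrow> C"
  shows "verts (cycle_graph (functional_graph C f)) = {z \<in> C. z \<in> orbit f z}"
    and "arcs (cycle_graph (functional_graph C f)) = (\<lambda>z. (z, f z)) ` {z \<in> C. z \<in> orbit f z}"
proof -
  let ?G = "functional_graph C f" and ?Z = "{z \<in> C. z \<in> orbit f z}"
  have cycle_sub: "set p \<subseteq> (\<lambda>z. (z, f z)) ` ?Z" if p: "pre_digraph.cycle ?G p" for p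
  proof -
    obtain u where u: "u \<in> C" "p = forward_walk f u (length p)" "(f ^^ length p) u = u" "p \<noteq> []"
      using p unfolding pre_digraph.cycle_def awalk_functional_graph_iff[OF assms] by metis
    then have "u \<in> orbit f u" by (auto simp: orbit_altdef intro!: exI[of _ "length p"])
    then have "(f ^^ i) u \<in> ?Z" for i
      using orbit_funpow(2) funpow_mem[OF assms u(1)] by simp
    moreover have "set p = (\<lambda>i. ((f ^^ i) u, f ((f ^^ i) u))) ` {0..<length p}"
      by (subst u(2)) (simp add: forward_walk_def)
    ultimately show ?thesis by auto
  qed
  have cycle_ex: "\<exists>p. pre_digraph.cycle ?G p \<and> (z, f z) \<in> set p" if "z \<in> ?Z" for z
  proof -
    let ?n = "card (orbit f z)" let ?p = "forward_walk f z ?n"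
    have z: "z \<in> C" "z \<in> orbit f z" using that by auto
    note enum = orbit_enumeration[OF z(2)]
    have tl_verts: "tl (pre_digraph.awalk_verts ?G z ?p) = map (\<lambda>i. (f ^^ i) (f z)) [0..<?n]"
      unfolding awalk_verts_forward_walk
      by (subst upt_conv_Cons) (auto simp: map_Suc_upt[symmetric] funpow_swap1 simp del: upt_Suc)
    \<comment> \<open>The tail of the vertex list is the enumeration of the same orbit starting from \<open>f z\<close>.\<close>
    have "f z \<in> orbit f (f z)" "orbit f (f z) = orbit f z"
      using orbit_funpow[OF z(2), of 1] by simp_all
    then have "bij_betw (\<lambda>k. (f ^^ k) (f z)) {0..<?n} (orbit f z)"
      using orbit_enumeration(1)[of "f z" f] by simp
    then have "distinct (tl (pre_digraph.awalk_verts ?G z ?p))"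
      unfolding tl_verts by (auto simp: distinct_map bij_betw_def)
    moreover have "pre_digraph.awalk ?G z ?p z"
      using z(1) enum(2) by (simp add: awalk_functional_graph_iff[OF assms])
    moreover have "?p \<noteq> []" using enum(3) by (metis length_forward_walk list.size(3) less_irrefl)
    ultimately have "pre_digraph.cycle ?G ?p" by (auto simp: pre_digraph.cycle_def)
    moreover have "(z, f z) \<in> set ?p"
      using enum(3) by (auto simp: forward_walk_def intro!: image_eqI[of _ _ 0])
    ultimately show ?thesis by blast
  qed
  show arcs: "arcs (cycle_graph ?G) = (\<lambda>z. (z, f z)) ` ?Z"
    using cycle_sub cycle_ex by (fastforce simp: cycle_graph_def)
  have "verts (cycle_graph ?G) = fst ` arcs (cycle_graph ?G)"
    by (auto simp: cycle_graph_def)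
  then show "verts (cycle_graph ?G) = ?Z"
    by (simp add: arcs image_image)
qed

text \<open>
  An isomorphism maps cycles to cycles. Applied to the inverse isomorphism as well, this makes the
  cycle length an invariant of the isomorphism type.
\<close>
lemma cycle_app_iso:
  assumes wf: "wf_digraph G" and hom: "pre_digraph.digraph_isomorphism G hom"
    and p: "pre_digraph.cycle G p"
  shows "pre_digraph.cycle (app_iso hom G) (map (iso_arcs hom) p)"
proof -
  interpret G: wf_digraph G by (fact wf)
  obtain u where u: "G.awalk u p u" "distinct (tl (G.awalk_verts u p))" "p \<noteq> []"
    using p by (auto simp: G.cycle_def)
  have sub: "set (tl (G.awalk_verts u p)) \<subseteq> verts G"
    using u(1) by (metis G.awalkE' list.set_sel(2) pre_digraph.awalk_verts_non_Nil subset_iff)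
  have "distinct (tl (map (iso_verts hom) (G.awalk_verts u p)))"
    using u(2) inj_on_subset[OF G.digraph_isomorphism_inj_on_verts[OF hom] sub]
    by (simp add: map_tl[symmetric] distinct_map)
  then show ?thesis
    using u G.awalk_app_isoI[OF u(1) hom] G.awalk_verts_app_iso_eq[OF hom u(1)]
    by (auto simp: pre_digraph.cycle_def intro!: exI[of _ "iso_verts hom u"])
qed

lemma cycle_length_iso:
  assumes wf: "wf_digraph G" and iso: "digraph_iso G H"
  shows "cycle_length H = cycle_length G"
proof -
  interpret G: wf_digraph G by (fact wf)
  obtain hom where hom: "G.digraph_isomorphism hom" and H: "H = app_iso hom G"
    using iso by (auto simp: digraph_iso_def)
  let ?inv = "G.inv_iso hom"
  have wfH: "wf_digraph H" unfolding H using hom by (rule G.wf_digraphI_app_iso)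
  have inv: "pre_digraph.digraph_isomorphism H ?inv" "app_iso ?inv H = G"
    using hom by (simp_all add: H G.digraph_isomorphism_invI)
  have arcs_sub: "set p \<subseteq> arcs K" if "pre_digraph.cycle K p" for K :: "('x, 'y) pre_digraph" and p
    using that by (auto simp: pre_digraph.cycle_def pre_digraph.awalk_def)
  have "arcs (cycle_graph H) = iso_arcs hom ` arcs (cycle_graph G)"
  proof (intro set_eqI iffI)
    fix e assume "e \<in> arcs (cycle_graph H)"
    then obtain p where p: "pre_digraph.cycle H p" "e \<in> set p" by (auto simp: cycle_graph_def)
    have "G.cycle (map (iso_arcs ?inv) p)"
      using cycle_app_iso[OF wfH inv(1) p(1)] inv(2) by simp
    then have "iso_arcs ?inv e \<in> arcs (cycle_graph G)"
      using p(2) by (auto simp: cycle_graph_def)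
    moreover have "e = iso_arcs hom (iso_arcs ?inv e)"
      using arcs_sub[OF p(1)] p(2) hom by (auto simp: H)
    ultimately show "e \<in> iso_arcs hom ` arcs (cycle_graph G)" by blast
  next
    fix e assume "e \<in> iso_arcs hom ` arcs (cycle_graph G)"
    then obtain p where "G.cycle p" "e \<in> iso_arcs hom ` set p" by (auto simp: cycle_graph_def)
    then show "e \<in> arcs (cycle_graph H)"
      using cycle_app_iso[OF wf hom] by (force simp: cycle_graph_def H)
  qed
  moreover have "arcs (cycle_graph G) \<subseteq> arcs G"
    using arcs_sub by (auto simp: cycle_graph_def)
  ultimately show ?thesis
    using inj_on_subset[OF G.digraph_isomorphism_inj_on_arcs[OF hom]]
    by (simp add: cycle_length_def card_image)
qed

section \<open>The trees attached to the cycles\<close>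

text \<open>
  The first periodic point on the forward path of \<open>s\<close>. The \<open>LEAST\<close> is meaningful for the elements
  of a finite set that \<open>f\<close> maps into itself.
\<close>
definition cycle_entry :: "('a \<Rightarrow> 'a) \<Rightarrow> 'a \<Rightarrow> 'a" where
  "cycle_entry f s = (f ^^ (LEAST m. (f ^^ m) s \<in> orbit f ((f ^^ m) s))) s"

text \<open>
  The vertex set of the tree rooted at a periodic point \<open>z\<close>. As a fibre of \<open>cycle_entry\<close> it makes
  the disjointness of the trees evident.
\<close>
definition branch :: "'a set \<Rightarrow> ('a \<Rightarrow> 'a) \<Rightarrow> 'a \<Rightarrow> 'a set" where
  "branch S f z = {s \<in> S. cycle_entry f s = z}"

text \<open>
  The rooted tree isomorphisms in terms of \<open>f\<close>: preserving arcs means commuting with \<open>f\<close> at every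
  vertex except the root, whose outgoing arc belongs to the cycle.
\<close>
definition branch_isos :: "'a set \<Rightarrow> ('a \<Rightarrow> 'a) \<Rightarrow> 'a \<Rightarrow> 'a \<Rightarrow> ('a \<Rightarrow> 'a) set" where
  "branch_isos S f z w = {\<alpha> \<in> extensional (branch S f z).
     bij_betw \<alpha> (branch S f z) (branch S f w) \<and> \<alpha> z = w \<and>
     (\<forall>s \<in> branch S f z - {z}. \<alpha> (f s) = f (\<alpha> s))}"

lemma cycle_entry_periodic [simp]: "z \<in> orbit f z \<Longrightarrow> cycle_entry f z = z"
  by (simp add: cycle_entry_def Least_eq_0)

lemma weak_components_eq:
  assumes "f \<in> S \<rightarrow> S" "weak_component S f C" "weak_component S f D" "s \<in> C" "s \<in> D"
  shows "C = D"
proof -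
  have "C \<subseteq> D" if C: "weak_component S f C" "s \<in> C" and D: "weak_component S f D" "s \<in> D" for C D
  proof
    fix t assume t: "t \<in> C"
    then obtain m n where "(f ^^ m) t = (f ^^ n) s"
      using weak_component_meet[OF C(1) _ C(2)] by blast
    moreover have "(f ^^ n) s \<in> D"
      using D by (auto simp: weak_component_def intro: funpow_mem)
    ultimately have "(f ^^ m) t \<in> D" by simp
    moreover have "t \<in> S" using C t by (auto simp: weak_component_def)
    ultimately show "t \<in> D" using weak_component_preimage[OF D(1) assms(1)] by blast
  qed
  then show ?thesis using assms by blast
qed

text \<open>
  A weak component has a single cycle: the forward paths of two periodic points meet, and a periodic
  point has the same orbit as every point on its forward path.
\<close>
lemma weak_component_periodic:
  assumes C: "weak_component S f C" and z: "z \<in> C" "z \<in> orbit f z"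
  shows "{y \<in> C. y \<in> orbit f y} = orbit f z"
proof (intro set_eqI iffI)
  fix y assume "y \<in> {y \<in> C. y \<in> orbit f y}"
  then have y: "y \<in> C" "y \<in> orbit f y" by auto
  then obtain m n where "(f ^^ m) y = (f ^^ n) z"
    using weak_component_meet[OF C _ z(1)] by blast
  then have "orbit f y = orbit f z"
    using orbit_funpow(1)[OF y(2), of m] orbit_funpow(1)[OF z(2), of n] by simp
  then show "y \<in> orbit f z" using y by simp
next
  fix y assume "y \<in> orbit f z"
  moreover then obtain n where "y = (f ^^ n) z" by (auto simp: orbit_altdef)
  ultimately show "y \<in> {y \<in> C. y \<in> orbit f y}"
    using C z self_in_orbit_trans[OF z(2)] by (auto simp: weak_component_def intro: funpow_mem)
qed

locale finite_selfmap =
  fixes S :: "'a set" and f :: "'a \<Rightarrow> 'a"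
  assumes finite_S: "finite S" and f_into: "f \<in> S \<rightarrow> S"
begin

lemma reaches_cycle:
  assumes "s \<in> S"
  shows "\<exists>m. (f ^^ m) s \<in> orbit f ((f ^^ m) s)"
proof -
  have "range (\<lambda>i. (f ^^ i) s) \<subseteq> S" using funpow_mem[OF f_into assms] by auto
  then have "\<not> inj (\<lambda>i. (f ^^ i) s)"
    using finite_S finite_subset finite_imageD infinite_UNIV_nat by blast
  then obtain i j where ij: "i < j" "(f ^^ i) s = (f ^^ j) s"
    unfolding inj_on_def by (metis linorder_neqE_nat)
  have "(f ^^ (j - i)) ((f ^^ i) s) = (f ^^ (j - i + i)) s" by (simp only: funpow_add comp_apply)
  also have "\<dots> = (f ^^ i) s" using ij by simp
  finally have "(f ^^ (j - i)) ((f ^^ i) s) = (f ^^ i) s" .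
  then have "(f ^^ i) s \<in> orbit f ((f ^^ i) s)"
    unfolding orbit_altdef mem_Collect_eq using ij(1) by (intro exI[of _ "j - i"]) simp
  then show ?thesis ..
qed

lemma cycle_entry_in_orbit:
  assumes "s \<in> S"
  shows "cycle_entry f s \<in> orbit f (cycle_entry f s)"
  unfolding cycle_entry_def using LeastI_ex[OF reaches_cycle[OF assms]] .

lemma cycle_entry_step:
  assumes "s \<in> S" "s \<notin> orbit f s"
  shows "cycle_entry f (f s) = cycle_entry f s"
proof -
  obtain m where "(f ^^ m) s \<in> orbit f ((f ^^ m) s)" using reaches_cycle[OF assms(1)] by blast
  from Least_Suc[of "\<lambda>m. (f ^^ m) s \<in> orbit f ((f ^^ m) s)", OF this] assms(2)
  show ?thesis by (simp add: cycle_entry_def funpow_swap1)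
qed

lemma cycle_entry_weak_component:
  assumes C: "weak_component S f C" and s: "s \<in> S"
  shows "cycle_entry f s \<in> C \<longleftrightarrow> s \<in> C"
proof
  assume "cycle_entry f s \<in> C"
  then show "s \<in> C"
    using weak_component_preimage[OF C f_into s] by (simp add: cycle_entry_def)
next
  assume "s \<in> C"
  then show "cycle_entry f s \<in> C"
    using C by (auto simp: cycle_entry_def weak_component_def intro: funpow_mem)
qed

lemma root_in_branch: "z \<in> S \<Longrightarrow> z \<in> orbit f z \<Longrightarrow> z \<in> branch S f z"
  by (simp add: branch_def)

lemma branch_nonroot:
  assumes "s \<in> branch S f z" "s \<noteq> z"
  shows "s \<notin> orbit f s" "f s \<in> branch S f z"
proof -
  show "s \<notin> orbit f s" using assms by (auto simp: branch_def)
  then show "f s \<in> branch S f z"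
    using assms(1) f_into cycle_entry_step by (auto simp: branch_def)
qed

lemma branch_subset:
  assumes "weak_component S f C" "z \<in> C"
  shows "branch S f z \<subseteq> C"
  using cycle_entry_weak_component[OF assms(1)] assms(2) by (auto simp: branch_def)

text \<open>
  A walk whose only cycle vertex is \<open>z\<close> may still go round a loop at \<open>z\<close> several times, so its
  length need not be minimal. The first periodic point of the forward path is nevertheless one of its
  vertices, hence it is \<open>z\<close>.
\<close>
lemma tree_verts_functional_graph:
  assumes C: "weak_component S f C" and z: "z \<in> C" "z \<in> orbit f z"
  shows "tree_verts (functional_graph C f) z = branch S f z"
proof -
  have f_C: "f \<in> C \<rightarrow> C" and "C \<subseteq> S" using C by (auto simp: weak_component_def)
  let ?G = "functional_graph C f" and ?Z = "{y \<in> C. y \<in> orbit f y}"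
  note cycle = cycle_graph_functional_graph(1)[OF f_C]
  show ?thesis
  proof (intro set_eqI iffI)
    fix s assume "s \<in> tree_verts ?G z"
    then obtain p where p: "pre_digraph.awalk ?G s p z"
      and first: "set (pre_digraph.awalk_verts ?G s p) \<inter> ?Z = {z}"
      unfolding tree_verts_def cycle by blast
    let ?n = "length p" let ?m = "LEAST m. (f ^^ m) s \<in> orbit f ((f ^^ m) s)"
    have s: "s \<in> C" and p_eq: "p = forward_walk f s ?n" and z_eq: "z = (f ^^ ?n) s"
      using p awalk_functional_graph_iff[OF f_C] by blast+
    have verts: "set (pre_digraph.awalk_verts ?G s p) = (\<lambda>i. (f ^^ i) s) ` {0..<Suc ?n}"
      by (subst p_eq) (simp only: awalk_verts_forward_walk set_map set_upt)
    have "(f ^^ ?n) s \<in> orbit f ((f ^^ ?n) s)" using z(2) z_eq by simp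
    then have "?m \<le> ?n" by (rule Least_le)
    then have "cycle_entry f s \<in> set (pre_digraph.awalk_verts ?G s p)"
      unfolding verts cycle_entry_def by (intro imageI) simp
    moreover have "cycle_entry f s \<in> ?Z"
      using cycle_entry_weak_component[OF C] cycle_entry_in_orbit s \<open>C \<subseteq> S\<close> by auto
    ultimately have "cycle_entry f s = z" using first by blast
    then show "s \<in> branch S f z" using s \<open>C \<subseteq> S\<close> by (auto simp: branch_def)
  next
    fix s assume s: "s \<in> branch S f z"
    let ?m = "LEAST m. (f ^^ m) s \<in> orbit f ((f ^^ m) s)" let ?p = "forward_walk f s ?m"
    have "s \<in> C" using s branch_subset[OF C z(1)] by auto
    have z_eq: "z = (f ^^ ?m) s" using s by (simp add: branch_def cycle_entry_def)
    have "pre_digraph.awalk ?G s ?p z"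
      using \<open>s \<in> C\<close> z_eq by (simp add: awalk_functional_graph_iff[OF f_C])
    moreover have "set (pre_digraph.awalk_verts ?G s ?p) \<inter> ?Z = {z}"
    proof (intro set_eqI iffI)
      fix y assume "y \<in> set (pre_digraph.awalk_verts ?G s ?p) \<inter> ?Z"
      then obtain i where i: "i \<le> ?m" "y = (f ^^ i) s" "y \<in> orbit f y"
        unfolding awalk_verts_forward_walk by (auto simp del: upt_Suc simp: less_Suc_eq_le)
      have "\<not> i < ?m"
      proof
        assume "i < ?m"
        from not_less_Least[OF this] show False using i by simp
      qed
      then have "i = ?m" using i(1) by linarith
      then show "y \<in> {z}" using i(2) z_eq by simp
    next
      fix y assume "y \<in> {z}"
      moreover have "z \<in> set (pre_digraph.awalk_verts ?G s ?p)"
        unfolding awalk_verts_forward_walk by (subst z_eq) (simp del: upt_Suc)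
      ultimately show "y \<in> set (pre_digraph.awalk_verts ?G s ?p) \<inter> ?Z" using z by simp
    qed
    ultimately show "s \<in> tree_verts ?G z"
      unfolding tree_verts_def cycle by blast
  qed
qed

lemma rooted_tree_functional_graph:
  assumes C: "weak_component S f C" and z: "z \<in> C" "z \<in> orbit f z"
  shows "rooted_tree (functional_graph C f) z =
    \<lparr>verts = branch S f z, arcs = (\<lambda>s. (s, f s)) ` (branch S f z - {z}), tail = fst, head = snd\<rparr>"
  unfolding rooted_tree_def tree_verts_functional_graph[OF assms]
  using branch_nonroot(2)[of _ z] branch_subset[OF C z(1)]
  by (intro pre_digraph.equality) auto

text \<open>
  A tree of a functional graph has the arcs \<open>(s, f s)\<close> for its vertices \<open>s\<close> other than the root.
  The image of \<open>(s, f s)\<close> under \<open>\<alpha>\<close> is again an arc exactly when \<open>\<alpha> (f s) = f (\<alpha> s)\<close>, and a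
  bijection that respects the roots then reaches every arc of the other tree.
\<close>
lemma tree_isos_functional_graph:
  assumes C: "weak_component S f C" "z \<in> C" "z \<in> orbit f z"
    and D: "weak_component S f D" "w \<in> D" "w \<in> orbit f w"
  shows "tree_isos (functional_graph C f) z (functional_graph D f) w = branch_isos S f z w"
proof -
  let ?G = "rooted_tree (functional_graph C f) z" and ?H = "rooted_tree (functional_graph D f) w"
  let ?B = "branch S f z" and ?B' = "branch S f w"
  note G = rooted_tree_functional_graph[OF C] and H = rooted_tree_functional_graph[OF D]
  have wf: "wf_digraph ?G" by unfold_locales (auto simp: G intro: branch_nonroot(2))
  have iso_iff: "pre_digraph.digraph_isomorphism ?G (pair_hom \<alpha>) \<longleftrightarrow> inj_on \<alpha> ?B" for \<alpha> :: "'a \<Rightarrow> 'a"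
    using digraph_isomorphism_pair_hom[OF wf, of \<alpha>] pre_digraph.digraph_isomorphism_inj_on_verts[of ?G "pair_hom \<alpha>"]
    by (auto simp: G pair_hom_def)
  have app_iff: "app_iso (pair_hom \<alpha>) ?G = ?H \<longleftrightarrow>
      \<alpha> ` ?B = ?B' \<and> (\<lambda>s. (\<alpha> s, \<alpha> (f s))) ` (?B - {z}) = (\<lambda>s. (s, f s)) ` (?B' - {w})" for \<alpha> :: "'a \<Rightarrow> 'a"
    by (simp add: G H app_iso_def pair_hom_def image_image)
  have arcs_iff: "(\<lambda>s. (\<alpha> s, \<alpha> (f s))) ` (?B - {z}) = (\<lambda>s. (s, f s)) ` (?B' - {w}) \<longleftrightarrow>
      (\<forall>s\<in>?B - {z}. \<alpha> (f s) = f (\<alpha> s))"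
    if \<alpha>: "inj_on \<alpha> ?B" "\<alpha> ` ?B = ?B'" "\<alpha> z = w" for \<alpha> :: "'a \<Rightarrow> 'a"
  proof
    assume "(\<lambda>s. (\<alpha> s, \<alpha> (f s))) ` (?B - {z}) = (\<lambda>s. (s, f s)) ` (?B' - {w})"
    then show "\<forall>s\<in>?B - {z}. \<alpha> (f s) = f (\<alpha> s)" by blast
  next
    assume "\<forall>s\<in>?B - {z}. \<alpha> (f s) = f (\<alpha> s)"
    then have "(\<lambda>s. (\<alpha> s, \<alpha> (f s))) ` (?B - {z}) = (\<lambda>s. (s, f s)) ` (\<alpha> ` (?B - {z}))"
      by (auto simp: image_image)
    moreover have "\<alpha> ` (?B - {z}) = ?B' - {w}"
      using \<alpha> root_in_branch C by (subst inj_on_image_set_diff[of \<alpha> ?B]) (auto simp: weak_component_def)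
    ultimately show "(\<lambda>s. (\<alpha> s, \<alpha> (f s))) ` (?B - {z}) = (\<lambda>s. (s, f s)) ` (?B' - {w})" by simp
  qed
  have verts: "verts ?G = ?B" by (simp add: G)
  have "\<alpha> \<in> tree_isos (functional_graph C f) z (functional_graph D f) w \<longleftrightarrow>
      \<alpha> \<in> branch_isos S f z w" for \<alpha>
  proof (cases "inj_on \<alpha> ?B \<and> \<alpha> ` ?B = ?B' \<and> \<alpha> z = w")
    case True
    then show ?thesis
      using arcs_iff[of \<alpha>]
      unfolding tree_isos_def rooted_isos_def branch_isos_def bij_betw_def iso_iff app_iff verts
        mem_Collect_eq by blast
  next
    case False
    then show ?thesis
      unfolding tree_isos_def rooted_isos_def branch_isos_def bij_betw_def iso_iff app_iff verts
        mem_Collect_eq by blast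
  qed
  then show ?thesis by blast
qed

lemma pseudocycleE:
  assumes "Q \<in> pseudocycles S f"
  obtains C where "weak_component S f C" "Q = functional_graph C f"
    "verts (cycle_graph Q) = {z \<in> C. z \<in> orbit f z}"
proof -
  obtain C where C: "weak_component S f C" "Q = functional_graph C f"
    using assms by (auto simp: pseudocycles_conv[OF f_into])
  show thesis
    using that[OF C] cycle_graph_functional_graph(1)[OF weak_component_into[OF C(1)]] C(2) by simp
qed

lemma verts_cycle_graph:
  assumes "Q \<in> pseudocycles S f"
  shows "verts (cycle_graph Q) = {z \<in> verts Q. z \<in> orbit f z}"
  using assms by (rule pseudocycleE) simp

lemma funpow_cycle_graph:
  assumes "Q \<in> pseudocycles S f" "z \<in> verts (cycle_graph Q)"
  shows "(f ^^ k) z \<in> verts (cycle_graph Q)"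
  using assms(1)
proof (rule pseudocycleE)
  fix C assume C: "weak_component S f C" "verts (cycle_graph Q) = {z \<in> C. z \<in> orbit f z}"
  then have z: "z \<in> C" "z \<in> orbit f z" using assms(2) by auto
  show ?thesis
    using funpow_mem[OF weak_component_into[OF C(1)] z(1)] orbit_funpow(2)[OF z(2)] C(2) by simp
qed

lemma tree_isos_pseudocycles:
  assumes "Q \<in> pseudocycles S f" "z \<in> verts (cycle_graph Q)"
    and "Q' \<in> pseudocycles S f" "w \<in> verts (cycle_graph Q')"
  shows "tree_isos Q z Q' w = branch_isos S f z w"
  using assms(1)
proof (rule pseudocycleE)
  fix C assume C: "weak_component S f C" "Q = functional_graph C f"
    "verts (cycle_graph Q) = {z \<in> C. z \<in> orbit f z}"
  show ?thesis
    using assms(3)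
  proof (rule pseudocycleE)
    fix D assume D: "weak_component S f D" "Q' = functional_graph D f"
      "verts (cycle_graph Q') = {z \<in> D. z \<in> orbit f z}"
    have "z \<in> C" "z \<in> orbit f z" "w \<in> D" "w \<in> orbit f w"
      using assms(2,4) C(3) D(3) by auto
    then show ?thesis using tree_isos_functional_graph[OF C(1) _ _ D(1)] C(2) D(2) by simp
  qed
qed

end

section \<open>Permutations that commute with the map\<close>

locale commuting_permutation = finite_selfmap +
  fixes g :: "'a \<Rightarrow> 'a"
  assumes g_commuting: "g \<in> commuting_perms S f"
begin

lemma g_permutes: "g permutes S" and g_commutes: "s \<in> S \<Longrightarrow> f (g s) = g (f s)"
  using g_commuting by (auto simp: commuting_perms_def)

lemma g_eq_iff [simp]: "g s = g t \<longleftrightarrow> s = t"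
  using permutes_inj[OF g_permutes] by (auto dest: injD)

lemma g_in_S_iff [simp]: "g s \<in> S \<longleftrightarrow> s \<in> S"
  using permutes_in_image[OF g_permutes] .

lemma funpow_commutes: "s \<in> S \<Longrightarrow> (f ^^ n) (g s) = g ((f ^^ n) s)"
  by (induction n) (simp_all add: g_commutes funpow_mem[OF f_into])

lemma periodic_image_iff: "s \<in> S \<Longrightarrow> g s \<in> orbit f (g s) \<longleftrightarrow> s \<in> orbit f s"
  by (simp add: orbit_altdef funpow_commutes)

lemma cycle_entry_image: "s \<in> S \<Longrightarrow> cycle_entry f (g s) = g (cycle_entry f s)"
  by (simp add: cycle_entry_def funpow_commutes periodic_image_iff funpow_mem[OF f_into])

lemma branch_image:
  assumes "z \<in> S"
  shows "g ` branch S f z = branch S f (g z)"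
proof (intro set_eqI iffI)
  fix t assume t: "t \<in> branch S f (g z)"
  then have "t \<in> g ` S" using permutes_image[OF g_permutes] by (simp add: branch_def)
  then obtain s where "s \<in> S" "t = g s" by blast
  with t show "t \<in> g ` branch S f z" by (auto simp: branch_def cycle_entry_image)
qed (auto simp: branch_def cycle_entry_image)

lemma restrict_in_branch_isos:
  assumes "z \<in> S" "z \<in> orbit f z"
  shows "restrict g (branch S f z) \<in> branch_isos S f z (g z)"
proof -
  have "bij_betw g (branch S f z) (branch S f (g z))"
    by (simp add: bij_betw_def branch_image[OF assms(1)] inj_on_def)
  moreover have "s \<in> S" if "s \<in> branch S f z" for s using that by (simp add: branch_def)
  ultimately show ?thesis
    using branch_nonroot(2) root_in_branch[OF assms] by (auto simp: branch_isos_def g_commutes)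
qed

lemma weak_component_image:
  assumes C: "weak_component S f C"
  shows "weak_component S f (g ` C)"
proof -
  note sub = weak_component_subset[OF C]
  have "f \<in> g ` C \<rightarrow> g ` C"
    using weak_component_into[OF C] sub by (auto simp: g_commutes subset_iff)
  moreover have "s \<in> g ` C" if s: "s \<in> S" "f s \<in> g ` C" for s
  proof -
    obtain t where t: "t \<in> S" "s = g t" using s(1) permutes_image[OF g_permutes] by blast
    then have "f t \<in> C" using s(2) by (auto simp: g_commutes)
    then have "t \<in> C" using C t(1) by (simp add: weak_component_def)
    then show ?thesis using t(2) by simp
  qed
  moreover have "\<exists>m n. (f ^^ m) (g u) = (f ^^ n) (g v)" if "u \<in> C" "v \<in> C" for u v
    using weak_component_meet[OF C that] that sub by (auto simp: funpow_commutes subset_iff)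
  ultimately show ?thesis
    using C sub by (auto simp: weak_component_def)
qed

text \<open>
  The permutation restricts to an isomorphism from \<open>Q\<close> to its image, so the image has the type of \<open>Q\<close>.
\<close>
lemma app_iso_pseudocycle_of_type:
  assumes Q: "Q \<in> pseudocycles_of_type S f T"
  shows "app_iso (pair_hom g) Q \<in> pseudocycles_of_type S f T"
proof -
  obtain C where C: "weak_component S f C" "Q = functional_graph C f"
    using Q by (auto simp: pseudocycles_of_type_def pseudocycles_conv[OF f_into])
  note sub = weak_component_subset[OF C(1)]
  have eq: "app_iso (pair_hom g) Q = functional_graph (g ` C) f"
    unfolding C(2) using sub by (intro app_iso_functional_graph) (auto simp: g_commutes)
  have wf: "wf_digraph Q" using wf_functional_graph[OF weak_component_into[OF C(1)]] C(2) by simp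
  have "pre_digraph.digraph_isomorphism Q (pair_hom g)"
    by (intro digraph_isomorphism_pair_hom wf) (auto simp: C(2) inj_on_def)
  then have "digraph_iso (app_iso (pair_hom g) Q) Q"
    using digraph_iso_swap[OF wf] unfolding digraph_iso_def by blast
  then have "digraph_iso (app_iso (pair_hom g) Q) T"
    using Q unfolding pseudocycles_of_type_def by (auto intro: digraph_iso_trans[of _ Q])
  then show ?thesis
    using weak_component_image[OF C(1)] eq
    by (auto simp: pseudocycles_of_type_def pseudocycles_conv[OF f_into])
qed

lemma induced_perm_permutes:
  "induced_perm (pseudocycles_of_type S f T) g permutes pseudocycles_of_type S f T"
proof (rule bij_imp_permutes)
  let ?PT = "pseudocycles_of_type S f T"
  have "?PT \<subseteq> (\<lambda>C. functional_graph C f) ` Pow S"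
    using weak_component_subset by (fastforce simp: pseudocycles_of_type_def pseudocycles_conv[OF f_into])
  then have "finite ?PT" using finite_S by (meson finite_Pow_iff finite_imageI finite_subset)
  moreover have "induced_perm ?PT g ` ?PT \<subseteq> ?PT"
    using app_iso_pseudocycle_of_type by (auto simp: induced_perm_def)
  moreover have "inj_on (induced_perm ?PT g) ?PT"
  proof (rule inj_onI)
    fix Q Q' assume Q: "Q \<in> ?PT" "Q' \<in> ?PT" "induced_perm ?PT g Q = induced_perm ?PT g Q'"
    then obtain C C' where C: "Q = functional_graph C f" "Q' = functional_graph C' f"
      by (auto simp: pseudocycles_of_type_def pseudocycles_conv[OF f_into])
    have "verts (app_iso (pair_hom g) Q) = verts (app_iso (pair_hom g) Q')"
      using Q by (simp add: induced_perm_def)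
    then have "g ` C = g ` C'" by (simp add: C pair_hom_def)
    then show "Q = Q'" using inj_image_eq_iff[OF permutes_inj[OF g_permutes]] C by simp
  qed
  ultimately show "bij_betw (induced_perm ?PT g) ?PT ?PT"
    using endo_inj_surj by (simp add: bij_betw_def)
qed (simp add: induced_perm_def)

end

section \<open>Restrictions of commuting permutations and their data\<close>

text \<open>
  The pseudocycles of one type, enumerated without repetition, with a marked cycle vertex in each. The
  enumeration is a parameter because a second instance of this situation arises from a triple
  \<open>(\<pi>, h, A)\<close>: the enumeration \<open>\<pi> \<circ> P\<close> with the marked vertices \<open>h \<circ> x\<close>.
\<close>
locale marked_pseudocycles = finite_selfmap S f
  for S :: "'a set" and f :: "'a \<Rightarrow> 'a" +
  fixes T :: "('b, 'b \<times> 'b) pre_digraph" and J :: "'j set"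
    and P :: "'j \<Rightarrow> ('a, 'a \<times> 'a) pre_digraph" and x :: "'j \<Rightarrow> 'a"
  assumes P_bij: "bij_betw P J (pseudocycles_of_type S f T)"
    and x_cycle: "j \<in> J \<Longrightarrow> x j \<in> verts (cycle_graph (P j))"
begin

abbreviation "PT \<equiv> pseudocycles_of_type S f T"
abbreviation "L \<equiv> cycle_length T"

definition "V = (\<Union>Q\<in>PT. verts Q)"

definition mark :: "'j \<times> nat \<Rightarrow> 'a" where
  "mark = (\<lambda>(j, k). (f ^^ k) (x j))"

definition indices :: "('j \<times> nat) set" where
  "indices = J \<times> {0..<L}"

lemma P_component:
  assumes "j \<in> J"
  shows "P j = functional_graph (verts (P j)) f" "weak_component S f (verts (P j))"
proof -
  have "P j \<in> PT" using P_bij assms by (auto simp: bij_betw_def)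
  then show "P j = functional_graph (verts (P j)) f" "weak_component S f (verts (P j))"
    by (auto simp: pseudocycles_of_type_def pseudocycles_conv[OF f_into])
qed

lemma P_in_PT: "j \<in> J \<Longrightarrow> P j \<in> PT"
  using P_bij by (auto simp: bij_betw_def)

lemma V_eq: "V = (\<Union>j\<in>J. verts (P j))"
  using bij_betw_imp_surj_on[OF P_bij] by (force simp: V_def)

lemma V_subset: "V \<subseteq> S"
  using weak_component_subset[OF P_component(2)] by (auto simp: V_eq)

lemma f_in_V_iff:
  assumes "s \<in> S"
  shows "f s \<in> V \<longleftrightarrow> s \<in> V"
proof -
  have "f s \<in> verts (P j) \<longleftrightarrow> s \<in> verts (P j)" if "j \<in> J" for j
    using P_component(2)[OF that] assms by (auto simp: weak_component_def)
  then show ?thesis by (auto simp: V_eq)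
qed

lemma PT_eqI:
  assumes "Q \<in> PT" "Q' \<in> PT" "s \<in> verts Q" "s \<in> verts Q'"
  shows "Q = Q'"
proof -
  obtain C C' where "weak_component S f C" "Q = functional_graph C f"
      "weak_component S f C'" "Q' = functional_graph C' f"
    using assms(1,2) by (auto simp: pseudocycles_of_type_def pseudocycles_conv[OF f_into])
  then show ?thesis using weak_components_eq[OF f_into, of C C' s] assms(3,4) by simp
qed

lemma x_periodic:
  assumes "j \<in> J"
  shows "x j \<in> verts (P j)" "x j \<in> orbit f (x j)"
proof -
  have "verts (cycle_graph (P j)) = {z \<in> verts (P j). z \<in> orbit f z}"
    using cycle_graph_functional_graph(1)[OF weak_component_into[OF P_component(2)[OF assms]]]
      P_component(1)[OF assms] by simp
  then show "x j \<in> verts (P j)" "x j \<in> orbit f (x j)" using x_cycle[OF assms] by auto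
qed

lemma x_in_V: "j \<in> J \<Longrightarrow> x j \<in> V"
  using x_periodic(1) by (auto simp: V_eq)

lemma mark_in_component:
  assumes "j \<in> J"
  shows "(f ^^ k) (x j) \<in> verts (P j)" "(f ^^ k) (x j) \<in> orbit f ((f ^^ k) (x j))"
  using funpow_mem[OF weak_component_into[OF P_component(2)[OF assms]] x_periodic(1)[OF assms]]
    orbit_funpow(2)[OF x_periodic(2)[OF assms]] by auto

lemma mark_in_S: "j \<in> J \<Longrightarrow> (f ^^ k) (x j) \<in> S"
  using mark_in_component(1) weak_component_subset[OF P_component(2)] by blast

lemma card_orbit_x:
  assumes j: "j \<in> J"
  shows "card (orbit f (x j)) = L"
proof -
  note C = P_component[OF j]
  let ?C = "verts (P j)"
  have "digraph_iso (P j) T" using P_in_PT[OF j] by (simp add: pseudocycles_of_type_def)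
  moreover have "wf_digraph (P j)"
    using wf_functional_graph[OF weak_component_into[OF C(2)]] C(1) by simp
  ultimately have "L = cycle_length (functional_graph ?C f)"
    using cycle_length_iso C(1) by metis
  also have "\<dots> = card ((\<lambda>z. (z, f z)) ` orbit f (x j))"
    using cycle_graph_functional_graph(2)[OF weak_component_into[OF C(2)]]
      weak_component_periodic[OF C(2) x_periodic[OF j]] by (simp add: cycle_length_def)
  also have "\<dots> = card (orbit f (x j))" by (intro card_image inj_onI) auto
  finally show ?thesis by simp
qed

lemma L_pos: "j \<in> J \<Longrightarrow> 0 < L"
  using orbit_enumeration(3)[OF x_periodic(2)] card_orbit_x by metis

lemma funpow_L: "j \<in> J \<Longrightarrow> (f ^^ L) (x j) = x j"
  using orbit_enumeration(2)[OF x_periodic(2)] card_orbit_x by metis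

text \<open>
  Distinct indices \<open>j\<close> belong to disjoint pseudocycles, and the first \<open>L\<close> iterates of a marked vertex
  are distinct since \<open>L\<close> is its least period.
\<close>
lemma mark_inj: "inj_on mark indices"
proof (rule inj_onI)
  fix a b assume ab: "a \<in> indices" "b \<in> indices" "mark a = mark b"
  then obtain j k i l where jk: "a = (j, k)" "b = (i, l)" "j \<in> J" "i \<in> J" "k < L" "l < L"
    by (auto simp: indices_def)
  have eq: "(f ^^ k) (x j) = (f ^^ l) (x i)" using ab(3) by (simp add: jk mark_def)
  then have "P j = P i"
    using PT_eqI[OF P_in_PT P_in_PT] mark_in_component(1)[of j k] mark_in_component(1)[of i l] jk
    by metis
  then have "j = i" using P_bij jk by (auto simp: bij_betw_def dest: inj_onD)
  moreover have "k = l"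
    using orbit_enumeration(1)[OF x_periodic(2)[OF jk(3)]] eq jk \<open>j = i\<close> card_orbit_x[OF jk(3)]
    by (auto simp: bij_betw_def dest: inj_onD)
  ultimately show "a = b" using jk by simp
qed

text \<open>
  The path of \<open>v\<close> enters the cycle of its own pseudocycle, which consists of the iterates of the
  marked vertex.
\<close>
lemma cycle_entry_marked:
  assumes "v \<in> V"
  obtains j k where "j \<in> J" "k < L" "v \<in> branch S f ((f ^^ k) (x j))"
proof -
  obtain j where j: "j \<in> J" "v \<in> verts (P j)" using assms by (auto simp: V_eq)
  note C = P_component(2)[OF j(1)]
  have "v \<in> S" using V_subset assms by auto
  then have "cycle_entry f v \<in> orbit f (x j)"
    using cycle_entry_weak_component[OF C] cycle_entry_in_orbit j(2)
      weak_component_periodic[OF C x_periodic[OF j(1)]] by blast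
  moreover have "(\<lambda>k. (f ^^ k) (x j)) ` {0..<L} = orbit f (x j)"
    using bij_betw_imp_surj_on[OF orbit_enumeration(1)[OF x_periodic(2)[OF j(1)]]]
      card_orbit_x[OF j(1)] by simp
  ultimately obtain k where "k < L" "cycle_entry f v = (f ^^ k) (x j)" by force
  then show ?thesis using that j(1) \<open>v \<in> S\<close> by (simp add: branch_def)
qed

lemma branch_marked_subset: "j \<in> J \<Longrightarrow> branch S f ((f ^^ k) (x j)) \<subseteq> V"
  using branch_subset[OF P_component(2) mark_in_component(1)] by (auto simp: V_eq)

lemma V_eq_branches: "V = (\<Union>i\<in>indices. branch S f (mark i))"
proof (intro set_eqI iffI)
  fix v assume "v \<in> V"
  then show "v \<in> (\<Union>i\<in>indices. branch S f (mark i))"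
    by (rule cycle_entry_marked) (force simp: indices_def mark_def)
next
  fix v assume "v \<in> (\<Union>i\<in>indices. branch S f (mark i))"
  then show "v \<in> V" using branch_marked_subset by (force simp: indices_def mark_def)
qed

lemma disjoint_branches: "disjoint_family_on (\<lambda>i. branch S f (mark i)) indices"
  using mark_inj by (auto simp: disjoint_family_on_def branch_def dest: inj_onD)

lemma verts_rooted_tree:
  assumes "j \<in> J"
  shows "verts (rooted_tree (P j) ((f ^^ k) (x j))) = branch S f ((f ^^ k) (x j))"
  by (subst P_component(1)[OF assms])
    (simp add: rooted_tree_functional_graph[OF P_component(2)[OF assms] mark_in_component[OF assms]])

definition restriction_data ::
    "('a \<Rightarrow> 'a) \<Rightarrow>
      (('a, 'a \<times> 'a) pre_digraph \<Rightarrow> ('a, 'a \<times> 'a) pre_digraph) \<times> ('a \<Rightarrow> 'a) \<times> ('j \<Rightarrow> nat \<Rightarrow> 'a \<Rightarrow> 'a)" where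
  "restriction_data r =
    (induced_perm PT r, restrict r (x ` J),
     \<lambda>j\<in>J. \<lambda>k\<in>{0..<L}. restrict r (verts (rooted_tree (P j) ((f ^^ k) (x j)))))"

definition admissible_data ::
    "((('a, 'a \<times> 'a) pre_digraph \<Rightarrow> ('a, 'a \<times> 'a) pre_digraph) \<times> ('a \<Rightarrow> 'a) \<times> ('j \<Rightarrow> nat \<Rightarrow> 'a \<Rightarrow> 'a)) set" where
  "admissible_data = {(\<pi>, h, A).
    \<pi> permutes PT \<and>
    (h \<in> x ` J \<rightarrow>\<^sub>E S \<and>
     (\<forall>j\<in>J. h (x j) \<in> verts (cycle_graph (\<pi> (P j))) \<and>
       (\<forall>k\<in>{0..<L}. trees_isomorphic (P j) ((f ^^ k) (x j)) (\<pi> (P j)) ((f ^^ k) (h (x j)))))) \<and>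
    A \<in> (\<Pi>\<^sub>E j\<in>J. \<Pi>\<^sub>E k\<in>{0..<L}.
      tree_isos (P j) ((f ^^ k) (x j)) (\<pi> (P j)) ((f ^^ k) (h (x j))))}"

lemma PT_pseudocycles: "Q \<in> PT \<Longrightarrow> Q \<in> pseudocycles S f"
  by (simp add: pseudocycles_of_type_def)

text \<open>
  This makes the data of a commuting permutation a function of its restriction to \<open>V\<close>. The arcs of a
  pseudocycle have both ends in \<open>V\<close>, so the induced map on pseudocycles depends on that
  restriction only.
\<close>
lemma restriction_data_cong:
  assumes "\<And>v. v \<in> V \<Longrightarrow> r v = r' v"
  shows "restriction_data r = restriction_data r'"
proof -
  have "induced_perm PT r Q = induced_perm PT r' Q" for Q
  proof (cases "Q \<in> PT")
    case True
    then show ?thesis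
    proof (rule pseudocycleE[OF PT_pseudocycles])
      fix C assume C: "weak_component S f C" "Q = functional_graph C f"
      have eq: "r s = r' s" if "s \<in> C" for s
        using assms that True C(2) by (force simp: V_def)
      moreover have "f s \<in> C" if "s \<in> C" for s using weak_component_into[OF C(1)] that by blast
      ultimately show ?thesis
        by (auto simp: induced_perm_def app_iso_def pair_hom_def C(2) image_image cong: image_cong)
    qed
  qed (simp add: induced_perm_def)
  moreover have "restrict r (x ` J) = restrict r' (x ` J)"
    using assms x_in_V by (intro restrict_ext) auto
  moreover have "restrict r (verts (rooted_tree (P j) ((f ^^ k) (x j)))) =
      restrict r' (verts (rooted_tree (P j) ((f ^^ k) (x j))))" if "j \<in> J" for j k
    using assms branch_marked_subset[OF that] verts_rooted_tree[OF that]
    by (auto simp: restrict_def fun_eq_iff)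
  then have "(\<lambda>j\<in>J. \<lambda>k\<in>{0..<L}. restrict r (verts (rooted_tree (P j) ((f ^^ k) (x j))))) =
      (\<lambda>j\<in>J. \<lambda>k\<in>{0..<L}. restrict r' (verts (rooted_tree (P j) ((f ^^ k) (x j)))))"
    by (auto simp: restrict_def fun_eq_iff)
  ultimately show ?thesis by (simp add: restriction_data_def fun_eq_iff)
qed

text \<open>
  The tree components alone already determine the function, because the trees cover \<open>V\<close>.
\<close>
lemma restriction_data_eqD:
  assumes "restriction_data r = restriction_data r'" "v \<in> V"
  shows "r v = r' v"
proof -
  obtain j k where jk: "j \<in> J" "k < L" "v \<in> branch S f ((f ^^ k) (x j))"
    using cycle_entry_marked[OF assms(2)] .
  have "restrict r (branch S f ((f ^^ k) (x j))) = restrict r' (branch S f ((f ^^ k) (x j)))"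
    using fun_cong[OF fun_cong[OF arg_cong[OF assms(1), of "\<lambda>d. snd (snd d)"], of j], of k] jk
    by (simp add: restriction_data_def verts_rooted_tree)
  from fun_cong[OF this, of v] show ?thesis using jk(3) by simp
qed

lemma restriction_data_admissible:
  assumes g: "g \<in> commuting_perms S f"
  shows "restriction_data g \<in> admissible_data"
proof -
  interpret commuting_permutation S f g by unfold_locales (fact g)
  let ?\<pi> = "induced_perm PT g"
  have cycle: "restrict g (x ` J) (x j) \<in> verts (cycle_graph (?\<pi> (P j)))" if j: "j \<in> J" for j
  proof -
    have "?\<pi> (P j) \<in> PT" "verts (?\<pi> (P j)) = g ` verts (P j)"
      using app_iso_pseudocycle_of_type[OF P_in_PT[OF j]] P_in_PT[OF j]
      by (simp_all add: induced_perm_def pair_hom_def)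
    then show ?thesis
      using verts_cycle_graph[OF PT_pseudocycles] x_periodic[OF j] mark_in_S[OF j, of 0] j
      by (simp add: periodic_image_iff)
  qed
  have trees: "restrict g (verts (rooted_tree (P j) ((f ^^ k) (x j)))) \<in>
      tree_isos (P j) ((f ^^ k) (x j)) (?\<pi> (P j)) ((f ^^ k) (restrict g (x ` J) (x j)))"
    if j: "j \<in> J" for j k
  proof -
    have source: "P j \<in> pseudocycles S f" using PT_pseudocycles[OF P_in_PT[OF j]] .
    have target: "?\<pi> (P j) \<in> pseudocycles S f"
      using PT_pseudocycles permutes_in_image[OF induced_perm_permutes] P_in_PT[OF j] by metis
    have "(f ^^ k) (restrict g (x ` J) (x j)) = g ((f ^^ k) (x j))"
      using funpow_commutes mark_in_S[OF j, of 0] j by simp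
    then have "tree_isos (P j) ((f ^^ k) (x j)) (?\<pi> (P j)) ((f ^^ k) (restrict g (x ` J) (x j))) =
        branch_isos S f ((f ^^ k) (x j)) (g ((f ^^ k) (x j)))"
      using tree_isos_pseudocycles[OF source funpow_cycle_graph[OF source x_cycle[OF j]]
          target funpow_cycle_graph[OF target cycle[OF j]]] by metis
    then show ?thesis
      using restrict_in_branch_isos mark_in_S mark_in_component(2) verts_rooted_tree j by simp
  qed
  have "restrict g (x ` J) \<in> x ` J \<rightarrow>\<^sub>E S"
    using mark_in_S[of _ 0] by auto
  moreover have "trees_isomorphic (P j) ((f ^^ k) (x j)) (?\<pi> (P j)) ((f ^^ k) (restrict g (x ` J) (x j)))"
    if "j \<in> J" for j k
    unfolding trees_isomorphic_def using trees[OF that] by blast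
  moreover have "(\<lambda>j\<in>J. \<lambda>k\<in>{0..<L}. restrict g (verts (rooted_tree (P j) ((f ^^ k) (x j))))) \<in>
      (\<Pi>\<^sub>E j\<in>J. \<Pi>\<^sub>E k\<in>{0..<L}.
        tree_isos (P j) ((f ^^ k) (x j)) (?\<pi> (P j)) ((f ^^ k) (restrict g (x ` J) (x j))))"
    unfolding restrict_PiE_iff using trees by blast
  ultimately show ?thesis
    unfolding restriction_data_def admissible_data_def mem_Collect_eq prod.case
    using induced_perm_permutes cycle by blast
qed

text \<open>
  The gluing construction. The tree isomorphisms fit together to a bijection of \<open>V\<close> because the
  marked vertices \<open>x\<^sub>j\<close> and the vertices \<open>h x\<^sub>j\<close> both index the trees in \<open>V\<close> bijectively. The
  induced permutation is \<open>\<pi>\<close> because the image of \<open>P\<^sub>j\<close> and \<open>\<pi> P\<^sub>j\<close> share the vertex \<open>h x\<^sub>j\<close>.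
\<close>
lemma admissible_data_realized:
  assumes "(\<pi>, h, A) \<in> admissible_data"
  obtains g where "g \<in> commuting_perms S f" "restriction_data g = (\<pi>, h, A)"
proof -
  have \<pi>: "\<pi> permutes PT" and h: "h \<in> x ` J \<rightarrow>\<^sub>E S"
    and h_cycle: "\<And>j. j \<in> J \<Longrightarrow> h (x j) \<in> verts (cycle_graph (\<pi> (P j)))"
    and A_ext: "A \<in> extensional J" "\<And>j. j \<in> J \<Longrightarrow> A j \<in> extensional {0..<L}"
    and A_tree: "\<And>j k. j \<in> J \<Longrightarrow> k < L \<Longrightarrow>
      A j k \<in> tree_isos (P j) ((f ^^ k) (x j)) (\<pi> (P j)) ((f ^^ k) (h (x j)))"
    using assms by (auto simp: admissible_data_def PiE_def Pi_def)
  interpret target: marked_pseudocycles S f T J "\<pi> \<circ> P" "h \<circ> x"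
  proof unfold_locales
    show "bij_betw (\<pi> \<circ> P) J PT"
      using bij_betw_trans[OF P_bij permutes_imp_bij[OF \<pi>]] .
  qed (simp add: h_cycle)
  have A: "A j k \<in> branch_isos S f ((f ^^ k) (x j)) ((f ^^ k) (h (x j)))" if "j \<in> J" "k < L" for j k
  proof -
    have source: "P j \<in> pseudocycles S f" and target: "\<pi> (P j) \<in> pseudocycles S f"
      using PT_pseudocycles P_in_PT[OF that(1)] target.P_in_PT[OF that(1)] by simp_all
    have "tree_isos (P j) ((f ^^ k) (x j)) (\<pi> (P j)) ((f ^^ k) (h (x j))) =
        branch_isos S f ((f ^^ k) (x j)) ((f ^^ k) (h (x j)))"
      using tree_isos_pseudocycles[OF source funpow_cycle_graph[OF source x_cycle[OF that(1)]]
          target funpow_cycle_graph[OF target h_cycle[OF that(1)]]] .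
    then show ?thesis using A_tree[OF that] by simp
  qed
  \<comment> \<open>The index of the tree containing \<open>v\<close> is read off from the root of that tree.\<close>
  define r where "r v = (case the_inv_into indices mark (cycle_entry f v) of (j, k) \<Rightarrow> A j k v)" for v
  have r_branch: "r v = A j k v" if "j \<in> J" "k < L" "v \<in> branch S f ((f ^^ k) (x j))" for j k v
  proof -
    have "(j, k) \<in> indices" "cycle_entry f v = mark (j, k)"
      using that by (simp_all add: indices_def mark_def branch_def)
    then have "the_inv_into indices mark (cycle_entry f v) = (j, k)"
      using the_inv_into_f_f[OF mark_inj] by simp
    then show ?thesis by (simp add: r_def)
  qed
  have "bij_betw r (\<Union>i\<in>indices. branch S f (mark i)) (\<Union>i\<in>indices. branch S f (target.mark i))"
  proof (rule bij_betw_UNION_disjoint)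
    show "disjoint_family_on (\<lambda>i. branch S f (target.mark i)) indices"
      using target.disjoint_branches by (simp add: target.indices_def indices_def)
    fix i assume "i \<in> indices"
    then obtain j k where jk: "i = (j, k)" "j \<in> J" "k < L" by (auto simp: indices_def)
    have "bij_betw (A j k) (branch S f (mark i)) (branch S f (target.mark i))"
      using A[OF jk(2,3)] by (simp add: branch_isos_def jk(1) mark_def target.mark_def)
    moreover have "A j k v = r v" if "v \<in> branch S f (mark i)" for v
      using r_branch[OF jk(2,3)] that by (simp add: jk(1) mark_def)
    ultimately show "bij_betw r (branch S f (mark i)) (branch S f (target.mark i))"
      using bij_betw_cong by blast
  qed
  moreover have "(\<Union>i\<in>indices. branch S f (target.mark i)) = V"
    using target.V_eq_branches by (simp add: target.V_def V_def target.indices_def indices_def)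
  ultimately have r_bij: "bij_betw r V V" by (simp add: V_eq_branches[symmetric])
  have r_mark: "r ((f ^^ k) (x j)) = (f ^^ k) (h (x j))" if "j \<in> J" "k < L" for j k
    using r_branch[OF that root_in_branch[OF mark_in_S mark_in_component(2)]] A[OF that] that
    by (simp add: branch_isos_def)
  have r_commutes: "r (f v) = f (r v)" if v: "v \<in> V" for v
  proof -
    obtain j k where jk: "j \<in> J" "k < L" "v \<in> branch S f ((f ^^ k) (x j))"
      using cycle_entry_marked[OF v] .
    show ?thesis
    proof (cases "v = (f ^^ k) (x j)")
      case False
      then show ?thesis
        using A[OF jk(1,2)] jk r_branch[OF jk(1,2)] branch_nonroot(2)[OF jk(3)]
        by (simp add: branch_isos_def)
    next
      case root: True
      show ?thesis
      \<comment> \<open>The last root of a cycle needs separate care: its image under \<open>f\<close> is \<open>x j\<close>, which carries index 0 and not \<open>L\<close>.\<close>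
      proof (cases "Suc k < L")
        case True
        then show ?thesis using r_mark[OF jk(1) True] r_mark[OF jk(1,2)] root by simp
      next
        case False
        then have "L = Suc k" using jk(2) by simp
        then have "f v = x j" "f (r v) = h (x j)"
          using funpow_L[OF jk(1)] target.funpow_L[OF jk(1)] r_mark[OF jk(1,2)] root by simp_all
        then show ?thesis using r_mark[OF jk(1) L_pos[OF jk(1)]] by simp
      qed
    qed
  qed
  define g where "g s = (if s \<in> V then r s else s)" for s
  have "bij_betw g V V" using r_bij by (simp add: g_def cong: bij_betw_cong)
  then have "g permutes V" by (rule bij_imp_permutes) (simp add: g_def)
  then have "g permutes S" using V_subset by (rule permutes_subset)
  moreover have "f (g s) = g (f s)" if "s \<in> S" for s
    using r_commutes f_in_V_iff[OF that] by (auto simp: g_def)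
  ultimately have g: "g \<in> commuting_perms S f" by (simp add: commuting_perms_def)
  interpret g: commuting_permutation S f g by unfold_locales (fact g)
  have g_V: "g v = r v" if "v \<in> V" for v using that by (simp add: g_def)
  have gx: "g (x j) = h (x j)" if "j \<in> J" for j
    using r_mark[OF that L_pos[OF that]] g_V[OF x_in_V[OF that]] by simp
  have "induced_perm PT g Q = \<pi> Q" for Q
  proof (cases "Q \<in> PT")
    case True
    then obtain j where j: "j \<in> J" "Q = P j" using P_bij by (auto simp: bij_betw_def)
    \<comment> \<open>Both candidates are pseudocycles through \<open>h (x j)\<close>, so they coincide.\<close>
    have "h (x j) \<in> verts (app_iso (pair_hom g) Q)"
      using x_periodic(1)[OF j(1)] gx[OF j(1)] by (force simp: pair_hom_def j(2))
    moreover have "h (x j) \<in> verts (\<pi> Q)" using target.x_periodic(1)[OF j(1)] by (simp add: j(2))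
    moreover have "\<pi> Q \<in> PT" using target.P_in_PT[OF j(1)] by (simp add: j(2))
    ultimately have "app_iso (pair_hom g) Q = \<pi> Q"
      using PT_eqI g.app_iso_pseudocycle_of_type[OF True] by blast
    then show ?thesis using True by (simp add: induced_perm_def)
  next
    case False
    then show ?thesis using permutes_not_in[OF \<pi>] by (simp add: induced_perm_def)
  qed
  moreover have "restrict g (x ` J) = h"
    using h gx by (auto simp: fun_eq_iff restrict_def PiE_def extensional_def)
  moreover have "(\<lambda>j\<in>J. \<lambda>k\<in>{0..<L}. restrict g (verts (rooted_tree (P j) ((f ^^ k) (x j))))) = A"
  proof (intro extensionalityI[OF restrict_extensional A_ext(1)])
    fix j assume j: "j \<in> J"
    have "(\<lambda>k\<in>{0..<L}. restrict g (verts (rooted_tree (P j) ((f ^^ k) (x j))))) = A j"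
    proof (intro extensionalityI[OF restrict_extensional A_ext(2)[OF j]])
      fix k assume k: "k \<in> {0..<L}"
      have "restrict g (branch S f ((f ^^ k) (x j))) = A j k"
      proof (rule extensionalityI[OF restrict_extensional])
        show "A j k \<in> extensional (branch S f ((f ^^ k) (x j)))"
          using A[OF j] k by (simp add: branch_isos_def)
        fix v assume v: "v \<in> branch S f ((f ^^ k) (x j))"
        then show "restrict g (branch S f ((f ^^ k) (x j))) v = A j k v"
          using r_branch[OF j _ v] g_V[OF subsetD[OF branch_marked_subset[OF j] v]] k by simp
      qed
      then show "(\<lambda>k\<in>{0..<L}. restrict g (verts (rooted_tree (P j) ((f ^^ k) (x j))))) k = A j k"
        using k by (simp add: verts_rooted_tree[OF j])
    qed
    then show "(\<lambda>j\<in>J. \<lambda>k\<in>{0..<L}. restrict g (verts (rooted_tree (P j) ((f ^^ k) (x j))))) j = A j"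
      using j by simp
  qed
  ultimately have "restriction_data g = (\<pi>, h, A)" by (simp add: restriction_data_def fun_eq_iff)
  with g that show ?thesis by blast
qed

theorem restriction_data_bij:
  "bij_betw restriction_data {restrict g V | g. g \<in> commuting_perms S f} admissible_data"
proof (rule bij_betw_imageI)
  show "inj_on restriction_data {restrict g V | g. g \<in> commuting_perms S f}"
  proof (rule inj_onI)
    fix r r' assume "r \<in> {restrict g V | g. g \<in> commuting_perms S f}"
      "r' \<in> {restrict g V | g. g \<in> commuting_perms S f}"
      and eq: "restriction_data r = restriction_data r'"
    then have "r \<in> extensional V" "r' \<in> extensional V" by auto
    then show "r = r'" using restriction_data_eqD[OF eq] by (rule extensionalityI)
  qed
  have restrict_eq: "restriction_data (restrict g V) = restriction_data g" for g
    by (rule restriction_data_cong) simp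
  show "restriction_data ` {restrict g V | g. g \<in> commuting_perms S f} = admissible_data"
  proof (intro set_eqI iffI)
    fix d assume "d \<in> restriction_data ` {restrict g V | g. g \<in> commuting_perms S f}"
    then obtain g where g: "g \<in> commuting_perms S f" "d = restriction_data (restrict g V)" by blast
    show "d \<in> admissible_data"
      unfolding g(2) restrict_eq by (rule restriction_data_admissible[OF g(1)])
  next
    fix d assume d: "d \<in> admissible_data"
    obtain \<pi> h A where d_eq: "d = (\<pi>, h, A)" by (rule prod_cases3)
    obtain g where g: "g \<in> commuting_perms S f" "restriction_data g = d"
      using admissible_data_realized[of \<pi> h A] d unfolding d_eq by blast
    then have "d = restriction_data (restrict g V)" by (simp only: restrict_eq)
    then show "d \<in> restriction_data ` {restrict g V | g. g \<in> commuting_perms S f}"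
      using g(1) by blast
  qed
qed

end

theorem theorem2p9:
  fixes S :: "'a set" and f :: "'a \<Rightarrow> 'a"
    and T :: "('b, 'b \<times> 'b) pre_digraph"
    and n :: nat and P :: "nat \<Rightarrow> ('a, 'a \<times> 'a) pre_digraph" and x :: "nat \<Rightarrow> 'a"
    and PT :: "('a, 'a \<times> 'a) pre_digraph set" and X V :: "'a set"
  assumes "finite S" and "f \<in> S \<rightarrow> S"
    and "is_pseudocycle T"
    and "PT = pseudocycles_of_type S f T"
    and "bij_betw P {1..n} PT"
    and "\<forall>j\<in>{1..n}. x j \<in> verts (cycle_graph (P j))"
    and "X = x ` {1..n}"
    and "V = (\<Union>Q\<in>PT. verts Q)"
  shows "\<exists>\<Phi>.
    (\<forall>g\<in>commuting_perms S f. \<Phi> (restrict g V) =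
       (induced_perm PT g,
        restrict g X,
        \<lambda>j\<in>{1..n}. \<lambda>k\<in>{0..<cycle_length T}.
          restrict g (verts (rooted_tree (P j) ((f ^^ k) (x j)))))) \<and>
    bij_betw \<Phi> {restrict g V | g. g \<in> commuting_perms S f}
      {(\<pi>, h, A).
        \<pi> permutes PT \<and>
        (h \<in> X \<rightarrow>\<^sub>E S \<and>
         (\<forall>j\<in>{1..n}. h (x j) \<in> verts (cycle_graph (\<pi> (P j))) \<and>
           (\<forall>k\<in>{0..<cycle_length T}.
             trees_isomorphic (P j) ((f ^^ k) (x j)) (\<pi> (P j)) ((f ^^ k) (h (x j)))))) \<and>
        A \<in> (\<Pi>\<^sub>E j\<in>{1..n}. \<Pi>\<^sub>E k\<in>{0..<cycle_length T}.
          tree_isos (P j) ((f ^^ k) (x j)) (\<pi> (P j)) ((f ^^ k) (h (x j))))}"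
proof -
  interpret M: marked_pseudocycles S f T "{1..n}" P x
    using assms by unfold_locales auto
  have V: "V = M.V" using assms by (simp add: M.V_def)
  show ?thesis
  proof (intro exI[of _ M.restriction_data] conjI ballI)
    fix g
    have "M.restriction_data (restrict g V) = M.restriction_data g"
      unfolding V by (rule M.restriction_data_cong) simp
    then show "M.restriction_data (restrict g V) =
       (induced_perm PT g, restrict g X,
        \<lambda>j\<in>{1..n}. \<lambda>k\<in>{0..<cycle_length T}.
          restrict g (verts (rooted_tree (P j) ((f ^^ k) (x j)))))"
      by (simp only: M.restriction_data_def assms(4,7))
  next
    show "bij_betw M.restriction_data {restrict g V | g. g \<in> commuting_perms S f}
      {(\<pi>, h, A).
        \<pi> permutes PT \<and>
        (h \<in> X \<rightarrow>\<^sub>E S \<and>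
         (\<forall>j\<in>{1..n}. h (x j) \<in> verts (cycle_graph (\<pi> (P j))) \<and>
           (\<forall>k\<in>{0..<cycle_length T}.
             trees_isomorphic (P j) ((f ^^ k) (x j)) (\<pi> (P j)) ((f ^^ k) (h (x j)))))) \<and>
        A \<in> (\<Pi>\<^sub>E j\<in>{1..n}. \<Pi>\<^sub>E k\<in>{0..<cycle_length T}.
          tree_isos (P j) ((f ^^ k) (x j)) (\<pi> (P j)) ((f ^^ k) (h (x j))))}"
      unfolding V assms(4,7) by (rule M.restriction_data_bij[unfolded M.admissible_data_def])
  qed
qed

end
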